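(* Let $T$ be one of the following finite $2$-transitive permutation groups on $Q=\{1,\ldots,q\}$, in its natural $2$-transitive action of the stated degree $q$: $S_6$ or $A_6$ ($q=6$); $\mathrm{PSL}(2,11)$ ($q=11$); $M_{12}$ ($q=12$); $A_7$ ($q=15$); $HS$ ($q=176$); or a group $T$ with $\mathrm{PSL}(n,\ell)\leq T\leq\mathrm{P\Gamma L}(n,\ell)$, $n>2$, $\ell$ a prime power, acting on the $q=(\ell^n-1)/(\ell-1)$ one-dimensional subspaces of $\mathbb{F}_\ell^n$. Let $\mathcal{I}=(\rho_1,\rho_2)$ where $\rho_1$ is the identity map of $T$ and $\rho_2$ is an outer automorphism of $T$, not induced by conjugation by an element of $N_{S_q}(T)$, with $\rho_2^2=\rho_1$ (both viewed as homomorphisms $T\to S_q$). Then the code $C(T,\mathcal{I})$ is neighbour transitive in the Hamming graph $H(2q,q)$.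
   Context: $S_q=\mathrm{Sym}(Q)$, acting on the right; $t\rho$ denotes the image of $t$ under $\rho$. For a homomorphism $\rho:T\to S_q$ put $\alpha(t,\rho)=(1^{t\rho},\ldots,q^{t\rho})\in Q^q$, and let $C(T,\mathcal{I})=\{(\alpha(t,\rho_1),\alpha(t,\rho_2)):t\in T\}\subseteq Q^{2q}$. The Hamming graph $H(m,q)$ has vertex set $Q^m$, two vertices being adjacent iff they differ in exactly one entry; its distance is the Hamming distance $d$, and its automorphism group is $S_q^m\rtimes S_m$ (permuting letters independently in each coordinate, and permuting coordinates). For a code $C\subseteq Q^m$, an automorphism of $C$ is an automorphism of $H(m,q)$ fixing $C$ setwise. For a vertex $\nu$ let $d(\nu,C)=\min\{d(\nu,\beta):\beta\in C\}$, and let $C_1=\{\nu:d(\nu,C)=1\}$ be the set of neighbours of $C$. $C$ is neighbour transitive if there is a group $G$ of automorphisms of $C$ such that both $C$ and $C_1$ are $G$-orbits. For these groups it is known that the subgroup of $\mathrm{Aut}(T)$ induced by conjugation by $N_{S_q}(T)$ has index $2$ in $\mathrm{Aut}(T)$. *)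

theory Defs
  imports
    "HOL-Analysis.Analysis"
    "HOL-Algebra.Algebra"
    "HOL-Library.Numeral_Type"
begin

section \<open>Graphs, designs and permutation groups\<close>

definition graph_auts :: "'a set \<Rightarrow> ('a \<Rightarrow> 'a \<Rightarrow> bool) \<Rightarrow> ('a \<Rightarrow> 'a) set" where
  "graph_auts V adj =
     {g \<in> Bij V. \<forall>x\<in>V. \<forall>y\<in>V. adj (g x) (g y) \<longleftrightarrow> adj x y}"

definition strongly_regular ::
    "'a set \<Rightarrow> ('a \<Rightarrow> 'a \<Rightarrow> bool) \<Rightarrow> nat \<Rightarrow> nat \<Rightarrow> nat \<Rightarrow> nat \<Rightarrow> bool" where
  "strongly_regular V adj v k l m \<longleftrightarrow>
     finite V \<and> card V = v \<and>
     (\<forall>x\<in>V. \<not> adj x x) \<and>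
     (\<forall>x\<in>V. \<forall>y\<in>V. adj x y \<longrightarrow> adj y x) \<and>
     (\<forall>x\<in>V. card {z \<in> V. adj x z} = k) \<and>
     (\<forall>x\<in>V. \<forall>y\<in>V. adj x y \<longrightarrow> card {z \<in> V. adj x z \<and> adj y z} = l) \<and>
     (\<forall>x\<in>V. \<forall>y\<in>V. x \<noteq> y \<and> \<not> adj x y \<longrightarrow> card {z \<in> V. adj x z \<and> adj y z} = m)"

definition steiner_system :: "nat \<Rightarrow> nat \<Rightarrow> 'a set \<Rightarrow> 'a set set \<Rightarrow> bool" where
  "steiner_system t k V \<B> \<longleftrightarrow>
     (\<forall>B\<in>\<B>. B \<subseteq> V \<and> card B = k) \<and>
     (\<forall>S. S \<subseteq> V \<and> card S = t \<longrightarrow> (\<exists>!B. B \<in> \<B> \<and> S \<subseteq> B))"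

definition two_transitive :: "'a set \<Rightarrow> ('a \<Rightarrow> 'a) set \<Rightarrow> bool" where
  "two_transitive Q T \<longleftrightarrow>
     (\<forall>i\<in>Q. \<forall>j\<in>Q. \<forall>k\<in>Q. \<forall>l\<in>Q. i \<noteq> j \<and> k \<noteq> l \<longrightarrow> (\<exists>t\<in>T. t i = k \<and> t j = l))"

text \<open>
  The symmetric group on \<open>{1..q}\<close> is \<^const>\<open>sym_group\<close>, whose multiplication is
  \<open>(\<circ>)\<close>, so that permutations act on the left. The image \<open>i\<^sup>t\<close> under the right action
  is \<open>t i\<close>; passing to the opposite group affects neither homomorphisms, subgroups,
  isomorphism types nor conjugation by all elements of a subgroup.
\<close>

abbreviation perm_group :: "nat \<Rightarrow> (nat \<Rightarrow> nat) set \<Rightarrow> (nat \<Rightarrow> nat) monoid" where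
  "perm_group q T \<equiv> (sym_group q)\<lparr>carrier := T\<rparr>"

definition induced_by_conjugation ::
    "('a, 'b) monoid_scheme \<Rightarrow> 'a set \<Rightarrow> 'a set \<Rightarrow> ('a \<Rightarrow> 'a) \<Rightarrow> bool" where
  "induced_by_conjugation G H T \<rho> \<longleftrightarrow>
     (\<exists>x\<in>H. \<forall>t\<in>T. \<rho> t = inv\<^bsub>G\<^esub> x \<otimes>\<^bsub>G\<^esub> t \<otimes>\<^bsub>G\<^esub> x)"


section \<open>Projective groups\<close>

text \<open>
  The coefficient ring is only required to be commutative so that the numeral type
  \<open>11\<close> (the integers modulo 11, which the library does not make an instance of
  \<^class>\<open>field\<close>) can be used; the definition is only meant for fields.
\<close>

definition proj_points :: "(('a::comm_ring_1) ^ 'n) set set" where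
  "proj_points = {range (\<lambda>c. c *s v) | v. v \<noteq> 0}"

lemma proj_points_field:
  "(proj_points :: (('a::field) ^ 'n) set set) = {S. vec.subspace S \<and> vec.dim S = 1}"
proof (intro equalityI subsetI)
  fix L :: "('a ^ 'n) set" assume "L \<in> proj_points"
  then obtain v where v: "v \<noteq> 0" "L = vec.span {v}"
    by (auto simp: proj_points_def vec.span_singleton)
  have "vec.dim L = 1"
    using v by (simp add: vec.dim_eq_card_independent vec.dim_span vec.dim_insert)
  then show "L \<in> {S. vec.subspace S \<and> vec.dim S = 1}"
    using v by (simp add: vec.subspace_span)
next
  fix L :: "('a ^ 'n) set" assume "L \<in> {S. vec.subspace S \<and> vec.dim S = 1}"
  then have L: "vec.subspace L" "vec.dim L = 1" by auto
  obtain B where B: "B \<subseteq> L" "vec.independent B" "L \<subseteq> vec.span B" "card B = 1"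
    using vec.basis_exists[of L] L(2) by metis
  then obtain v where v: "B = {v}" by (auto simp: card_1_singleton_iff)
  then have "v \<noteq> 0" using B(2) vec.dependent_zero by auto
  moreover have "L = vec.span {v}"
    using B v L(1) vec.span_minimal by blast
  ultimately show "L \<in> proj_points"
    by (auto simp: proj_points_def vec.span_singleton)
qed

definition PSL :: "((('a::comm_ring_1) ^ 'n) set \<Rightarrow> ('a ^ 'n) set) set" where
  "PSL = {(\<lambda>L\<in>proj_points. (*v) A ` L) | A. det A = 1}"

definition semilinear_bij :: "(('a::field) ^ 'n \<Rightarrow> 'a ^ 'n) \<Rightarrow> bool" where
  "semilinear_bij f \<longleftrightarrow>
     bij f \<and> (\<forall>x y. f (x + y) = f x + f y) \<and>
     (\<exists>\<sigma>. bij \<sigma> \<and> (\<forall>a b. \<sigma> (a + b) = \<sigma> a + \<sigma> b) \<and> (\<forall>a b. \<sigma> (a * b) = \<sigma> a * \<sigma> b) \<and>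
          (\<forall>c x. f (c *s x) = \<sigma> c *s f x))"

definition PGammaL :: "((('a::field) ^ 'n) set \<Rightarrow> ('a ^ 'n) set) set" where
  "PGammaL = {(\<lambda>L\<in>proj_points. f ` L) | f. semilinear_bij f}"

definition transport :: "'a set \<Rightarrow> 'b set \<Rightarrow> ('a \<Rightarrow> 'b) \<Rightarrow> ('a \<Rightarrow> 'a) \<Rightarrow> 'b \<Rightarrow> 'b" where
  "transport Q P \<phi> t = (\<lambda>L\<in>P. \<phi> (t (inv_into Q \<phi> L)))"


section \<open>The groups in the list\<close>

text \<open>
  The automorphism groups of the Steiner systems \<open>S(5,6,12)\<close>; such a system is unique
  up to isomorphism.
\<close>

definition is_M12 :: "(nat \<Rightarrow> nat) set \<Rightarrow> bool" where
  "is_M12 T \<longleftrightarrow>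
     (\<exists>\<B>. steiner_system 5 6 {1..12} \<B> \<and> T = {p. p permutes {1..12} \<and> (`) p ` \<B> = \<B>})"

text \<open>
  The Higman--Sims graph is the unique strongly regular graph with parameters
  \<open>(100, 22, 0, 6)\<close>; its automorphism group is \<open>HS:2\<close>, with derived subgroup the simple
  group \<open>HS\<close>.
\<close>

definition is_HS :: "('a, 'b) monoid_scheme \<Rightarrow> bool" where
  "is_HS G \<longleftrightarrow>
     (\<exists>adj. strongly_regular {1..100::nat} adj 100 22 0 6 \<and>
        G \<cong> (BijGroup {1..100})
              \<lparr>carrier := derived (BijGroup {1..100}) (graph_auts {1..100} adj)\<rparr>)"

text \<open>
  For \<open>PSL(2,11)\<close>, \<open>A\<^sub>7\<close> and \<open>HS\<close>, the stated action is determined, up to conjugacy in the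
  symmetric group, as the 2-transitive permutation group of the given degree and isomorphism
  type. The predicate below is therefore only meant for 2-transitive \<open>T\<close>.
\<close>

definition sporadic_case :: "nat \<Rightarrow> (nat \<Rightarrow> nat) set \<Rightarrow> bool" where
  "sporadic_case q T \<longleftrightarrow>
     q = 6 \<and> T = carrier (sym_group 6) \<or>
     q = 6 \<and> T = carrier (alt_group 6) \<or>
     q = 11 \<and> perm_group q T \<cong>
       (BijGroup proj_points)\<lparr>carrier := (PSL :: ((11 ^ 2) set \<Rightarrow> (11 ^ 2) set) set)\<rparr> \<or>
     q = 12 \<and> is_M12 T \<or>
     q = 15 \<and> perm_group q T \<cong> alt_group 7 \<or>
     q = 176 \<and> is_HS (perm_group q T)"

text \<open>
  \<open>\<phi>\<close> labels the one-dimensional subspaces of \<open>\<bbbF>\<^sub>\<ell>\<^sup>n\<close> by \<open>1, \<dots>, q\<close>; here \<open>\<bbbF>\<^sub>\<ell>\<close> is the finite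
  field \<open>'f\<close> and \<open>n\<close> is the cardinality of \<open>'n\<close>. The bijection forces
  \<open>q = (\<ell>\<^sup>n - 1) / (\<ell> - 1)\<close>.
\<close>

definition projective_case ::
    "(nat \<Rightarrow> (('f::{field,finite}) ^ 'n) set) \<Rightarrow> nat \<Rightarrow> (nat \<Rightarrow> nat) set \<Rightarrow> bool" where
  "projective_case \<phi> q T \<longleftrightarrow>
     CARD('n) > 2 \<and> bij_betw \<phi> {1..q} proj_points \<and>
     PSL \<subseteq> transport {1..q} proj_points \<phi> ` T \<and>
     transport {1..q} proj_points \<phi> ` T \<subseteq> PGammaL"


section \<open>Codes in Hamming graphs\<close>

text \<open>Words of length \<open>m\<close> are extensional functions on the coordinate set \<open>{1..m}\<close>.\<close>

definition hamming_verts :: "nat \<Rightarrow> nat \<Rightarrow> (nat \<Rightarrow> nat) set" where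
  "hamming_verts m q = {1..m} \<rightarrow>\<^sub>E {1..q}"

definition hamming_dist :: "nat \<Rightarrow> (nat \<Rightarrow> nat) \<Rightarrow> (nat \<Rightarrow> nat) \<Rightarrow> nat" where
  "hamming_dist m u v = card {i \<in> {1..m}. u i \<noteq> v i}"

definition hamming_adj :: "nat \<Rightarrow> (nat \<Rightarrow> nat) \<Rightarrow> (nat \<Rightarrow> nat) \<Rightarrow> bool" where
  "hamming_adj m u v \<longleftrightarrow> hamming_dist m u v = 1"

definition code_auts :: "nat \<Rightarrow> nat \<Rightarrow> (nat \<Rightarrow> nat) set \<Rightarrow> ((nat \<Rightarrow> nat) \<Rightarrow> (nat \<Rightarrow> nat)) set" where
  "code_auts m q C = {g \<in> graph_auts (hamming_verts m q) (hamming_adj m). g ` C = C}"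

definition dist_to_code :: "nat \<Rightarrow> (nat \<Rightarrow> nat) \<Rightarrow> (nat \<Rightarrow> nat) set \<Rightarrow> nat" where
  "dist_to_code m v C = Min (hamming_dist m v ` C)"

definition code_neighbours :: "nat \<Rightarrow> nat \<Rightarrow> (nat \<Rightarrow> nat) set \<Rightarrow> (nat \<Rightarrow> nat) set" where
  "code_neighbours m q C = {v \<in> hamming_verts m q. dist_to_code m v C = 1}"

definition neighbour_transitive :: "nat \<Rightarrow> nat \<Rightarrow> (nat \<Rightarrow> nat) set \<Rightarrow> bool" where
  "neighbour_transitive m q C \<longleftrightarrow>
     C \<subseteq> hamming_verts m q \<and>
     (\<exists>G. subgroup G (BijGroup (hamming_verts m q)) \<and> G \<subseteq> code_auts m q C \<and>
        C \<in> orbits ((BijGroup (hamming_verts m q))\<lparr>carrier := G\<rparr>)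
              (hamming_verts m q) (\<lambda>g. g) \<and>
        code_neighbours m q C \<in> orbits ((BijGroup (hamming_verts m q))\<lparr>carrier := G\<rparr>)
              (hamming_verts m q) (\<lambda>g. g))"

definition perm_word :: "nat \<Rightarrow> 't \<Rightarrow> ('t \<Rightarrow> nat \<Rightarrow> nat) \<Rightarrow> nat \<Rightarrow> nat" where
  "perm_word q t \<rho> = (\<lambda>i\<in>{1..q}. \<rho> t i)"

definition join_words :: "nat \<Rightarrow> (nat \<Rightarrow> nat) \<Rightarrow> (nat \<Rightarrow> nat) \<Rightarrow> nat \<Rightarrow> nat" where
  "join_words q u v = (\<lambda>i\<in>{1..2 * q}. if i \<le> q then u i else v (i - q))"

definition perm_code ::
    "nat \<Rightarrow> 't set \<Rightarrow> ('t \<Rightarrow> nat \<Rightarrow> nat) \<times> ('t \<Rightarrow> nat \<Rightarrow> nat) \<Rightarrow> (nat \<Rightarrow> nat) set" where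
  "perm_code q T \<I> =
     {join_words q (perm_word q t (fst \<I>)) (perm_word q t (snd \<I>)) | t. t \<in> T}"

end

theory Submission
  imports Defs
begin

text \<open>
  For \<open>a, b \<in> T\<close>, permuting the coordinates of the two halves by \<open>a\<close> and \<open>\<rho>\<^sub>2 a\<close> and their
  letters by \<open>b\<close> and \<open>\<rho>\<^sub>2 b\<close> sends the codeword of \<open>t\<close> to that of \<open>b t a\<close>; since \<open>\<rho>\<^sub>2\<close> is an
  involution, exchanging the two halves sends it to that of \<open>\<rho>\<^sub>2 t\<close>. Hence the automorphism
  group is transitive on the code. The stabiliser of the codeword of \<open>1\<close> contains the maps with
  \<open>b = a\<^sup>-\<^sup>1\<close>, which by 2-transitivity permute transitively the changes of one letter within the
  first half, and the exchange of the halves, which carries these to the second half.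
\<close>

section \<open>Automorphisms of Hamming graphs and codes\<close>

lemma finite_hamming_verts: "finite (hamming_verts m q)"
  unfolding hamming_verts_def by (intro finite_PiE) auto

lemma hamming_verts_fun_upd:
  assumes "v \<in> hamming_verts m q" "i \<in> {1..m}" "x \<in> {1..q}"
  shows "v(i := x) \<in> hamming_verts m q"
  using assms by (auto simp: hamming_verts_def PiE_iff extensional_def)

lemma hamming_dist_eq_0_iff:
  assumes "u \<in> hamming_verts m q" "v \<in> hamming_verts m q"
  shows "hamming_dist m u v = 0 \<longleftrightarrow> u = v"
proof
  assume "hamming_dist m u v = 0"
  then have "\<forall>i\<in>{1..m}. u i = v i"
    by (auto simp: hamming_dist_def)
  then show "u = v"
    using assms unfolding hamming_verts_def by (metis PiE_ext)
qed (simp add: hamming_dist_def)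

text \<open>A minimum of natural numbers is 1 iff 1 is attained and 0 is not, and distance 0 means
  equality. This trades the minimum for membership and adjacency, which code automorphisms
  preserve.\<close>

lemma code_neighbours_eq:
  assumes "C \<subseteq> hamming_verts m q" "C \<noteq> {}"
  shows "code_neighbours m q C =
    {v \<in> hamming_verts m q. v \<notin> C \<and> (\<exists>c\<in>C. hamming_adj m v c)}"
proof -
  have "dist_to_code m v C = 1 \<longleftrightarrow> v \<notin> C \<and> (\<exists>c\<in>C. hamming_adj m v c)"
    if v: "v \<in> hamming_verts m q" for v
  proof -
    have "finite C"
      using assms(1) finite_hamming_verts finite_subset by blast
    then have "dist_to_code m v C = 1 \<longleftrightarrow>
        (\<exists>c\<in>C. hamming_dist m v c = 1) \<and> (\<forall>c\<in>C. hamming_dist m v c \<ge> 1)"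
      unfolding dist_to_code_def using assms(2) by (subst Min_eq_iff) force+
    moreover have "hamming_dist m v c \<ge> 1 \<longleftrightarrow> v \<noteq> c" if "c \<in> C" for c
      using hamming_dist_eq_0_iff[OF v, of c] that assms(1) by (metis less_one linorder_not_le subsetD)
    ultimately show ?thesis
      unfolding hamming_adj_def by blast
  qed
  then show ?thesis
    unfolding code_neighbours_def by blast
qed

section \<open>Automorphism groups of codes and their orbits\<close>

text \<open>The group of all automorphisms of the code is the witness \<open>G\<close> for
  \<open>neighbour_transitive\<close>.\<close>

lemma subgroup_code_auts:
  assumes C: "C \<subseteq> hamming_verts m q"
  shows "subgroup (code_auts m q C) (BijGroup (hamming_verts m q))"
proof -
  let ?V = "hamming_verts m q"
  interpret B: group "BijGroup ?V"
    by (rule group_BijGroup)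
  show ?thesis
  proof (rule B.subgroupI)
    show "code_auts m q C \<subseteq> carrier (BijGroup ?V)"
      by (auto simp: code_auts_def graph_auts_def BijGroup_def)
    have "(\<lambda>x\<in>?V. x) \<in> code_auts m q C"
      using C by (auto simp: code_auts_def graph_auts_def id_Bij)
    then show "code_auts m q C \<noteq> {}"
      by blast
  next
    fix g assume "g \<in> code_auts m q C"
    then have g: "g \<in> Bij ?V" "g ` C = C"
        "\<And>x y. x \<in> ?V \<Longrightarrow> y \<in> ?V \<Longrightarrow> hamming_adj m (g x) (g y) \<longleftrightarrow> hamming_adj m x y"
      by (auto simp: code_auts_def graph_auts_def)
    have bij: "bij_betw g ?V ?V"
      using g(1) by (simp add: Bij_def)
    \<comment> \<open>The inverse in \<open>BijGroup\<close>, restricted so that it is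
      extensional.\<close>
    define h where "h = (\<lambda>x\<in>?V. inv_into ?V g x)"
    have h: "h x \<in> ?V" "g (h x) = x" if "x \<in> ?V" for x
      using bij that unfolding h_def
      by (auto simp: bij_betw_def inv_into_into f_inv_into_f)
    have hg: "h (g x) = x" if "x \<in> ?V" for x
      using bij that unfolding h_def by (auto simp: bij_betw_def)
    have "h ` C = h ` (g ` C)"
      using g(2) by simp
    also have "\<dots> = C"
      using hg C by (force simp: image_image)
    finally have "h ` C = C" .
    moreover have "h \<in> Bij ?V"
      unfolding h_def by (rule restrict_inv_into_Bij[OF g(1)])
    moreover have "hamming_adj m (h x) (h y) \<longleftrightarrow> hamming_adj m x y" if "x \<in> ?V" "y \<in> ?V" for x y
      using g(3)[of "h x" "h y"] h that by simp
    ultimately show "inv\<^bsub>BijGroup ?V\<^esub> g \<in> code_auts m q C"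
      by (simp add: inv_BijGroup[OF g(1)] h_def[symmetric] code_auts_def graph_auts_def)
  next
    fix g h assume "g \<in> code_auts m q C" "h \<in> code_auts m q C"
    then have *: "g \<in> Bij ?V" "h \<in> Bij ?V" "g ` C = C" "h ` C = C"
        "\<forall>x\<in>?V. \<forall>y\<in>?V. hamming_adj m (g x) (g y) \<longleftrightarrow> hamming_adj m x y"
        "\<forall>x\<in>?V. \<forall>y\<in>?V. hamming_adj m (h x) (h y) \<longleftrightarrow> hamming_adj m x y"
      by (auto simp: code_auts_def graph_auts_def)
    have "compose ?V g h ` C = g ` h ` C"
      using C by (auto simp: compose_def image_image)
    moreover have "h x \<in> ?V" if "x \<in> ?V" for x
      using *(2) that Bij_imp_funcset by blast
    ultimately show "g \<otimes>\<^bsub>BijGroup ?V\<^esub> h \<in> code_auts m q C"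
      using * by (simp add: BijGroup_def code_auts_def graph_auts_def compose_Bij compose_eq)
  qed
qed

lemma code_auts_image_neighbours:
  assumes C: "C \<subseteq> hamming_verts m q" "C \<noteq> {}"
    and g: "g \<in> code_auts m q C" and v: "v \<in> code_neighbours m q C"
  shows "g v \<in> code_neighbours m q C"
proof -
  let ?V = "hamming_verts m q"
  from v obtain c where c: "v \<in> ?V" "v \<notin> C" "c \<in> C" "hamming_adj m v c"
    unfolding code_neighbours_eq[OF C] by blast
  have *: "bij_betw g ?V ?V" "g ` C = C" "hamming_adj m (g v) (g c)"
    using g c C(1) by (auto simp: code_auts_def graph_auts_def Bij_def)
  then have "g v \<in> ?V" "g v \<notin> g ` C" "g c \<in> C"
    using c(1-3) inj_on_image_mem_iff[OF _ c(1) C(1), of g] by (auto simp: bij_betw_def)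
  then show ?thesis
    using * unfolding code_neighbours_eq[OF C] by auto
qed

text \<open>The code and its neighbour set are invariant under all code automorphisms, so each is an
  orbit once every element is reached from one base point.\<close>

lemma neighbour_transitiveI:
  assumes C: "C \<subseteq> hamming_verts m q"
    and c: "c \<in> C" "\<And>x. x \<in> C \<Longrightarrow> \<exists>g\<in>code_auts m q C. g c = x"
    and v: "v \<in> code_neighbours m q C"
      "\<And>x. x \<in> code_neighbours m q C \<Longrightarrow> \<exists>g\<in>code_auts m q C. g v = x"
  shows "neighbour_transitive m q C"
proof -
  let ?V = "hamming_verts m q" and ?N = "code_neighbours m q C" and ?G = "code_auts m q C"
  have "C = {g c | g. g \<in> ?G}"
    using c by (force simp: code_auts_def)
  moreover have "?N = {g v | g. g \<in> ?G}"
    using v code_auts_image_neighbours[OF C] c(1) by blast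
  moreover have "c \<in> ?V" "v \<in> ?V"
    using c(1) C v(1) by (auto simp: code_neighbours_def)
  ultimately have "C \<in> orbits ((BijGroup ?V)\<lparr>carrier := ?G\<rparr>) ?V (\<lambda>g. g)"
      "?N \<in> orbits ((BijGroup ?V)\<lparr>carrier := ?G\<rparr>) ?V (\<lambda>g. g)"
    by (simp_all add: orbits_def orbit_def) blast+
  then show ?thesis
    unfolding neighbour_transitive_def using C subgroup_code_auts[OF C] by blast
qed

section \<open>Automorphisms permuting coordinates and letters\<close>

text \<open>For bijective \<sigma> and \<open>\<tau> i\<close> these are the elements of the wreath
  product of the symmetric groups on letters and coordinates. Coordinates are pulled back: the entry
  at \<open>\<sigma> i\<close> moves to \<open>i\<close>.\<close>

definition hamming_map ::
    "nat \<Rightarrow> nat \<Rightarrow> (nat \<Rightarrow> nat) \<Rightarrow> (nat \<Rightarrow> nat \<Rightarrow> nat) \<Rightarrow> (nat \<Rightarrow> nat) \<Rightarrow> nat \<Rightarrow> nat" where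
  "hamming_map m q \<sigma> \<tau> = (\<lambda>v\<in>hamming_verts m q. \<lambda>i\<in>{1..m}. \<tau> i (v (\<sigma> i)))"

context
  fixes m q :: nat and \<sigma> :: "nat \<Rightarrow> nat" and \<tau> :: "nat \<Rightarrow> nat \<Rightarrow> nat"
  assumes \<sigma>: "bij_betw \<sigma> {1..m} {1..m}"
    and \<tau>: "\<And>i. i \<in> {1..m} \<Longrightarrow> bij_betw (\<tau> i) {1..q} {1..q}"
begin

lemma hamming_map_closed:
  assumes "v \<in> hamming_verts m q"
  shows "hamming_map m q \<sigma> \<tau> v \<in> hamming_verts m q"
proof -
  have "\<tau> i (v (\<sigma> i)) \<in> {1..q}" if i: "i \<in> {1..m}" for i
  proof -
    have "v (\<sigma> i) \<in> {1..q}"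
      using assms bij_betwE[OF \<sigma>] i unfolding hamming_verts_def by (blast dest: PiE_mem)
    then show ?thesis
      using bij_betwE[OF \<tau>[OF i]] by blast
  qed
  then show ?thesis
    using assms by (simp add: hamming_map_def hamming_verts_def)
qed

text \<open>By injectivity of \<open>\<tau> i\<close> the images differ at \<open>i\<close> iff the
  words differ at \<open>\<sigma> i\<close>, and \<sigma> matches the two sets of positions
  bijectively.\<close>

lemma hamming_dist_hamming_map:
  assumes u: "u \<in> hamming_verts m q" and v: "v \<in> hamming_verts m q"
  shows "hamming_dist m (hamming_map m q \<sigma> \<tau> u) (hamming_map m q \<sigma> \<tau> v) = hamming_dist m u v"
proof -
  have "\<tau> i (u (\<sigma> i)) = \<tau> i (v (\<sigma> i)) \<longleftrightarrow> u (\<sigma> i) = v (\<sigma> i)" if i: "i \<in> {1..m}" for i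
  proof -
    have "u (\<sigma> i) \<in> {1..q}" "v (\<sigma> i) \<in> {1..q}"
      using u v bij_betwE[OF \<sigma>] i unfolding hamming_verts_def by (blast dest: PiE_mem)+
    then show ?thesis
      using \<tau>[OF i] by (metis bij_betw_imp_inj_on inj_on_eq_iff)
  qed
  then have "{i \<in> {1..m}. hamming_map m q \<sigma> \<tau> u i \<noteq> hamming_map m q \<sigma> \<tau> v i} =
      {i \<in> {1..m}. u (\<sigma> i) \<noteq> v (\<sigma> i)}" (is "?A = ?B")
    using u v by (auto simp: hamming_map_def)
  moreover have "bij_betw \<sigma> ?B {i \<in> {1..m}. u i \<noteq> v i}"
  proof (rule bij_betw_subset[OF \<sigma>])
    have "\<sigma> ` {1..m} = {1..m}"
      using \<sigma> by (rule bij_betw_imp_surj_on)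
    then show "\<sigma> ` ?B = {i \<in> {1..m}. u i \<noteq> v i}"
      by fast
  qed auto
  then have "card ?B = card {i \<in> {1..m}. u i \<noteq> v i}"
    by (rule bij_betw_same_card)
  ultimately show ?thesis
    unfolding hamming_dist_def by (simp only:)
qed

text \<open>Preserving distance forces injectivity, and by finiteness an injective self-map of the
  vertex set or of the code is onto; so the inclusion \<open>into\<close> suffices.\<close>

lemma hamming_map_code_aut:
  assumes C: "C \<subseteq> hamming_verts m q" and into: "hamming_map m q \<sigma> \<tau> ` C \<subseteq> C"
  shows "hamming_map m q \<sigma> \<tau> \<in> code_auts m q C"
proof -
  let ?V = "hamming_verts m q" and ?g = "hamming_map m q \<sigma> \<tau>"
  have inj: "inj_on ?g ?V"
  proof (rule inj_onI)
    fix u v assume "u \<in> ?V" "v \<in> ?V" "?g u = ?g v"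
    then show "u = v"
      using hamming_dist_hamming_map[of u v] hamming_dist_eq_0_iff[of u m q v]
        hamming_dist_eq_0_iff[of "hamming_map m q \<sigma> \<tau> u" m q "hamming_map m q \<sigma> \<tau> v"]
      by (simp add: hamming_map_closed)
  qed
  then have "?g ` ?V = ?V"
    using hamming_map_closed by (intro endo_inj_surj finite_hamming_verts) auto
  moreover have "?g ` C = C"
    using C inj into finite_hamming_verts by (intro endo_inj_surj) (auto intro: finite_subset inj_on_subset)
  moreover have "?g \<in> extensional ?V"
    by (simp add: hamming_map_def)
  ultimately show ?thesis
    using inj hamming_dist_hamming_map
    by (simp add: code_auts_def graph_auts_def Bij_def bij_betw_def hamming_adj_def)
qed

text \<open>Reduces the image of a word with one changed entry, such as a neighbour of the code, to
  the image of the unchanged word.\<close>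

lemma hamming_map_fun_upd:
  assumes u: "u \<in> hamming_verts m q" and i: "i \<in> {1..m}" and x: "x \<in> {1..q}"
  shows "hamming_map m q \<sigma> \<tau> (u(\<sigma> i := x)) = (hamming_map m q \<sigma> \<tau> u)(i := \<tau> i x)"
proof -
  have "\<sigma> i \<in> {1..m}"
    using bij_betwE[OF \<sigma>] i by blast
  then have upd: "u(\<sigma> i := x) \<in> hamming_verts m q"
    using hamming_verts_fun_upd[OF u _ x] by blast
  have inj: "\<sigma> j \<noteq> \<sigma> i" if "j \<in> {1..m}" "j \<noteq> i" for j
    using \<sigma> i that by (metis bij_betw_imp_inj_on inj_on_eq_iff)
  show ?thesis
  proof
    fix j
    show "hamming_map m q \<sigma> \<tau> (u(\<sigma> i := x)) j = ((hamming_map m q \<sigma> \<tau> u)(i := \<tau> i x)) j"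
      using u upd i inj[of j] by (cases "j = i"; cases "j \<in> {1..m}") (auto simp: hamming_map_def)
  qed
qed

end


section \<open>The code of an involutory automorphism\<close>

text \<open>The codeword of \<open>t\<close> in the case where the first homomorphism is the
  identity, with \<open>join_words\<close> and \<open>perm_word\<close> unfolded into one
  function.\<close>

definition twisted_word :: "nat \<Rightarrow> ((nat \<Rightarrow> nat) \<Rightarrow> nat \<Rightarrow> nat) \<Rightarrow> (nat \<Rightarrow> nat) \<Rightarrow> nat \<Rightarrow> nat" where
  "twisted_word q \<rho> t = (\<lambda>i\<in>{1..2 * q}. if i \<le> q then t i else \<rho> t (i - q))"

text \<open>The group laws are stated for plain functions, to allow calculation with entries of
  words. As a homomorphism that is its own inverse, \<rho> is an automorphism of
  \<open>T\<close>.\<close>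

locale involutory_twist =
  fixes q :: nat and T :: "(nat \<Rightarrow> nat) set" and \<rho> :: "(nat \<Rightarrow> nat) \<Rightarrow> nat \<Rightarrow> nat"
  assumes q: "q \<ge> 2"
    and T_permutes: "t \<in> T \<Longrightarrow> t permutes {1..q}"
    and T_id: "id \<in> T"
    and T_comp: "s \<in> T \<Longrightarrow> t \<in> T \<Longrightarrow> s \<circ> t \<in> T"
    and T_inv: "t \<in> T \<Longrightarrow> inv' t \<in> T"
    and T_two_transitive: "two_transitive {1..q} T"
    and \<rho>_closed: "t \<in> T \<Longrightarrow> \<rho> t \<in> T"
    and \<rho>_comp: "s \<in> T \<Longrightarrow> t \<in> T \<Longrightarrow> \<rho> (s \<circ> t) = \<rho> s \<circ> \<rho> t"
    and \<rho>_invol: "t \<in> T \<Longrightarrow> \<rho> (\<rho> t) = t"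
begin

abbreviation code :: "(nat \<Rightarrow> nat) set" where
  "code \<equiv> twisted_word q \<rho> ` T"

lemma T_mem_iff: "t \<in> T \<Longrightarrow> t i \<in> {1..q} \<longleftrightarrow> i \<in> {1..q}"
  by (rule permutes_in_image[OF T_permutes])

lemma twisted_word_vert:
  assumes t: "t \<in> T"
  shows "twisted_word q \<rho> t \<in> hamming_verts (2 * q) q"
proof -
  have "t i \<in> {1..q}" if "i \<in> {1..q}" for i
    using T_mem_iff t that by blast
  moreover have "\<rho> t (i - q) \<in> {1..q}" if "i \<in> {1..2 * q}" "\<not> i \<le> q" for i
    using T_mem_iff[OF \<rho>_closed[OF t], of "i - q"] that by auto
  ultimately show ?thesis
    unfolding twisted_word_def hamming_verts_def by (auto simp: PiE_iff)
qed

lemma code_verts: "code \<subseteq> hamming_verts (2 * q) q"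
  using twisted_word_vert by blast

section \<open>Exchange of the two halves\<close>

definition swap :: "(nat \<Rightarrow> nat) \<Rightarrow> nat \<Rightarrow> nat" where
  "swap = hamming_map (2 * q) q (\<lambda>i. if i \<le> q then i + q else i - q) (\<lambda>_. id)"

lemma swap_coord_bij:
  "bij_betw (\<lambda>i. if i \<le> q then i + q else i - q) {1..2 * q} {1..2 * q}"
  by (rule bij_betw_byWitness[where f' = "\<lambda>i. if i \<le> q then i + q else i - q"]) auto

text \<open>The exchanged word has first half \<open>\<rho> t\<close> and second half
  \<open>t\<close>, and \<open>t\<close> equals \<open>\<rho> (\<rho> t)\<close> because \<rho> is
  an involution.\<close>

lemma swap_twisted_word:
  assumes "t \<in> T"
  shows "swap (twisted_word q \<rho> t) = twisted_word q \<rho> (\<rho> t)"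
proof -
  let ?w = "twisted_word q \<rho> t"
  have "swap ?w = (\<lambda>i\<in>{1..2 * q}. ?w (if i \<le> q then i + q else i - q))"
    using twisted_word_vert[OF assms] by (simp add: swap_def hamming_map_def)
  also have "\<dots> = twisted_word q \<rho> (\<rho> t)"
    unfolding twisted_word_def by (rule restrict_ext) (auto simp: \<rho>_invol[OF assms])
  finally show ?thesis .
qed

lemma swap_code_aut: "swap \<in> code_auts (2 * q) q code"
proof -
  have "swap ` code \<subseteq> code"
    using swap_twisted_word \<rho>_closed by auto
  then show ?thesis
    using hamming_map_code_aut[OF swap_coord_bij _ code_verts, of "\<lambda>_. id"]
    unfolding swap_def by simp
qed

section \<open>Two-sided multiplication by elements of the group\<close>

definition mult_coord :: "(nat \<Rightarrow> nat) \<Rightarrow> nat \<Rightarrow> nat" where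
  "mult_coord a i = (if i \<le> q then a i else \<rho> a (i - q) + q)"

text \<open>Right multiplication by \<open>a\<close> acts on coordinates and left multiplication by
  \<open>b\<close> on letters. The second half uses the images under \<rho>, so that both halves
  still come from a single element of \<open>T\<close>.\<close>

definition mult_map :: "(nat \<Rightarrow> nat) \<Rightarrow> (nat \<Rightarrow> nat) \<Rightarrow> (nat \<Rightarrow> nat) \<Rightarrow> nat \<Rightarrow> nat" where
  "mult_map a b = hamming_map (2 * q) q (mult_coord a) (\<lambda>i. if i \<le> q then b else \<rho> b)"

lemma mult_coord_bij:
  assumes a: "a \<in> T"
  shows "bij_betw (mult_coord a) {1..2 * q} {1..2 * q}"
proof -
  have a': "\<rho> a \<in> T"
    using \<rho>_closed a by blast
  have mem: "1 \<le> t i \<and> t i \<le> q \<longleftrightarrow> 1 \<le> i \<and> i \<le> q" if "t \<in> T" for t i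
    using T_mem_iff[OF that, of i] by simp
  have into: "mult_coord a i \<in> {1..2 * q}" "mult_coord a i \<le> q \<longleftrightarrow> i \<le> q" if i: "i \<in> {1..2 * q}" for i
    using i mem[OF a, of i] mem[OF a', of "i - q"] by (auto simp: mult_coord_def)
  have "inj_on (mult_coord a) {1..2 * q}"
  proof (rule inj_onI)
    fix i j assume ij: "i \<in> {1..2 * q}" "j \<in> {1..2 * q}" "mult_coord a i = mult_coord a j"
    have "inj a" "inj (\<rho> a)"
      using T_permutes permutes_inj a a' by blast+
    \<comment> \<open>In the second half only the shifted indices are compared. The truncated
      subtraction is undone afterwards, since \<open>into(2)\<close> puts \<open>i\<close> and
      \<open>j\<close> in the same half.\<close>
    then have "if i \<le> q then i = j else i - q = j - q"
      using ij into(2)[of i] into(2)[of j] by (auto simp: mult_coord_def inj_eq split: if_splits)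
    then show "i = j"
      using into(2)[of i] into(2)[of j] ij by (auto split: if_splits)
  qed
  moreover from this have "mult_coord a ` {1..2 * q} = {1..2 * q}"
    using into(1) by (intro endo_inj_surj) auto
  ultimately show ?thesis
    by (simp add: bij_betw_def)
qed

lemma mult_letter_bij:
  assumes "b \<in> T"
  shows "bij_betw (if (i::nat) \<le> q then b else \<rho> b) {1..q} {1..q}"
  using permutes_imp_bij[OF T_permutes[OF assms]]
    permutes_imp_bij[OF T_permutes[OF \<rho>_closed[OF assms]]]
  by (cases "i \<le> q") simp_all

text \<open>The first half composes directly; in the second, \<open>\<rho> b\<close>,
  \<open>\<rho> t\<close> and \<open>\<rho> a\<close> combine because \<rho> is a
  homomorphism.\<close>

lemma mult_map_twisted_word:
  assumes "a \<in> T" "b \<in> T" "t \<in> T"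
  shows "mult_map a b (twisted_word q \<rho> t) = twisted_word q \<rho> (b \<circ> t \<circ> a)"
proof -
  let ?w = "twisted_word q \<rho> t"
  have mem: "1 \<le> t i \<and> t i \<le> q \<longleftrightarrow> 1 \<le> i \<and> i \<le> q" if "t \<in> T" for t i
    using T_mem_iff[OF that, of i] by simp
  have "\<rho> (b \<circ> t \<circ> a) = \<rho> b \<circ> \<rho> t \<circ> \<rho> a"
    using assms by (simp add: \<rho>_comp T_comp)
  moreover have "(if i \<le> q then b else \<rho> b) (?w (mult_coord a i)) =
      (if i \<le> q then b (t (a i)) else \<rho> b (\<rho> t (\<rho> a (i - q))))" if "i \<in> {1..2 * q}" for i
    using that mem[OF assms(1), of i] mem[OF \<rho>_closed[OF assms(1)], of "i - q"]
    by (auto simp: mult_coord_def twisted_word_def)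
  ultimately have "(\<lambda>i\<in>{1..2 * q}. (if i \<le> q then b else \<rho> b) (?w (mult_coord a i))) =
      twisted_word q \<rho> (b \<circ> t \<circ> a)"
    unfolding twisted_word_def[of _ _ "b \<circ> t \<circ> a"] by (intro restrict_ext) simp
  then show ?thesis
    using twisted_word_vert[OF assms(3)] by (simp add: mult_map_def hamming_map_def)
qed

lemma mult_map_code_aut:
  assumes "a \<in> T" "b \<in> T"
  shows "mult_map a b \<in> code_auts (2 * q) q code"
proof -
  have "mult_map a b ` code \<subseteq> code"
    using mult_map_twisted_word assms T_comp by auto
  then show ?thesis
    unfolding mult_map_def
    by (rule hamming_map_code_aut
        [OF mult_coord_bij[OF assms(1)] mult_letter_bij[OF assms(2)] code_verts])
qed

section \<open>Transitivity on neighbours and on the code\<close>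

text \<open>Position 1 of the codeword of \<open>id\<close> holds the letter 1. The changed position
  and the new letter form the pair (1, 2) of distinct points, to which 2-transitivity
  applies.\<close>

definition base_neighbour :: "nat \<Rightarrow> nat" where
  "base_neighbour = (twisted_word q \<rho> id)(1 := 2)"

lemma base_neighbour_mem: "base_neighbour \<in> code_neighbours (2 * q) q code"
proof -
  have vert: "base_neighbour \<in> hamming_verts (2 * q) q"
    unfolding base_neighbour_def
    using q by (intro hamming_verts_fun_upd twisted_word_vert[OF T_id]) auto
  have "{i \<in> {1..2 * q}. base_neighbour i \<noteq> twisted_word q \<rho> id i} = {1}"
    using q by (auto simp: base_neighbour_def twisted_word_def)
  then have "hamming_adj (2 * q) base_neighbour (twisted_word q \<rho> id)"
    unfolding hamming_adj_def hamming_dist_def by simp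
  moreover have "base_neighbour \<notin> code"
  proof
    assume "base_neighbour \<in> code"
    then obtain t where t: "t \<in> T" "base_neighbour = twisted_word q \<rho> t"
      by blast
    \<comment> \<open>The letter 2 stands at both positions 1 and 2 of
      \<open>base_neighbour\<close>, which no permutation allows.\<close>
    have "t 1 = t 2"
      using fun_cong[OF t(2), of 1] fun_cong[OF t(2), of 2] q
      by (simp add: base_neighbour_def twisted_word_def)
    then show False
      using permutes_inj[OF T_permutes[OF t(1)]] by (simp add: inj_eq)
  qed
  ultimately show ?thesis
    using vert T_id code_neighbours_eq[OF code_verts] by blast
qed

text \<open>A multiplication is sought that takes the codeword of \<open>id\<close> to that of
  \<open>t\<close>, position 1 to \<open>i\<close> and letter 2 to \<open>k\<close>. By
  2-transitivity some \<open>c\<close> sends (1, 2) to (\<open>i\<close>, \<open>inv' t k\<close>),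
  a pair of distinct points because \<open>k\<close> differs from \<open>t i\<close>.\<close>

lemma first_half_neighbour:
  assumes t: "t \<in> T" and i: "i \<in> {1..q}" and k: "k \<in> {1..q}" "k \<noteq> t i"
  shows "\<exists>g\<in>code_auts (2 * q) q code. g base_neighbour = (twisted_word q \<rho> t)(i := k)"
proof -
  have t_inv: "t (inv' t k) = k"
    using T_permutes[OF t] by (metis permutes_inverses(1))
  then have "inv' t k \<in> {1..q}" "i \<noteq> inv' t k"
    using T_mem_iff[OF t, of "inv' t k"] k by auto
  moreover have "(1::nat) \<in> {1..q}" "2 \<in> {1..q}" "(1::nat) \<noteq> 2"
    using q by auto
  ultimately obtain c where c: "c \<in> T" "c 1 = i" "c 2 = inv' t k"
    using T_two_transitive i unfolding two_transitive_def by blast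
  \<comment> \<open>These give \<open>b \<circ> a = t\<close>, \<open>a i = 1\<close> and
    \<open>b 2 = k\<close>.\<close>
  define a b where "a = inv' c" and "b = t \<circ> c"
  have ab: "a \<in> T" "b \<in> T"
    using a_def b_def c(1) t T_inv T_comp by auto
  have "inj c"
    using permutes_inj[OF T_permutes[OF c(1)]] .
  then have "mult_coord a i = 1"
    using c(2) i by (auto simp: mult_coord_def a_def inv_f_eq)
  moreover have "b 2 = k"
    using c(3) t_inv by (simp add: b_def)
  moreover have "b \<circ> id \<circ> a = t"
    using permutes_inv_o(1)[OF T_permutes[OF c(1)]] by (simp add: a_def b_def comp_assoc)
  ultimately have "mult_map a b base_neighbour = (twisted_word q \<rho> t)(i := k)"
    using hamming_map_fun_upd[OF mult_coord_bij[OF ab(1)] mult_letter_bij[OF ab(2)]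
        twisted_word_vert[OF T_id], of i 2] i q mult_map_twisted_word[OF ab T_id]
    unfolding base_neighbour_def mult_map_def by simp
  then show ?thesis
    using mult_map_code_aut[OF ab] by blast
qed

lemma code_neighbours_transitive:
  assumes v: "v \<in> code_neighbours (2 * q) q code"
  shows "\<exists>g\<in>code_auts (2 * q) q code. g base_neighbour = v"
proof -
  let ?V = "hamming_verts (2 * q) q" and ?G = "code_auts (2 * q) q code"
  have "code \<noteq> {}"
    using T_id by blast
  then obtain t where t: "t \<in> T" and vV: "v \<in> ?V"
    and adj: "hamming_adj (2 * q) v (twisted_word q \<rho> t)"
    using v unfolding code_neighbours_eq[OF code_verts \<open>code \<noteq> {}\<close>] by blast
  then obtain i where i: "{j \<in> {1..2 * q}. v j \<noteq> twisted_word q \<rho> t j} = {i}"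
    unfolding hamming_adj_def hamming_dist_def by (meson card_1_singletonE)
  define k where "k = v i"
  have i': "i \<in> {1..2 * q}" "k \<noteq> twisted_word q \<rho> t i"
    using i k_def by auto
  have k: "k \<in> {1..q}"
    using vV i'(1) unfolding k_def hamming_verts_def by (rule PiE_mem)
  have "v = (twisted_word q \<rho> t)(i := k)"
  proof
    fix j
    show "v j = ((twisted_word q \<rho> t)(i := k)) j"
    proof (cases "j \<in> {1..2 * q}")
      case True
      then show ?thesis
        using i by (auto simp: k_def)
    next
      case False
      \<comment> \<open>Outside the coordinate set both words take the default value of extensional
        functions.\<close>
      then have "v j = undefined"
        using vV unfolding hamming_verts_def by (intro PiE_arb)
      then show ?thesis
        using False i'(1) by (auto simp: twisted_word_def)
    qed
  qed
  note v_eq = this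
  show ?thesis
  proof (cases "i \<le> q")
    case True
    then show ?thesis
      using first_half_neighbour[OF t _ k, of i] i' v_eq by (simp add: twisted_word_def)
  next
    case False
    define j where "j = i - q"
    have j: "j \<in> {1..q}" "k \<noteq> \<rho> t j"
      using False i' by (auto simp: j_def twisted_word_def)
    \<comment> \<open>The codeword of \<open>\<rho> t\<close> is used because the exchange of halves
      turns it into that of \<open>t\<close> and carries position \<open>j\<close> to
      \<open>i\<close>.\<close>
    then obtain g where g: "g \<in> ?G" "g base_neighbour = (twisted_word q \<rho> (\<rho> t))(j := k)"
      using first_half_neighbour[OF \<rho>_closed[OF t] _ k] by blast
    have "swap ((twisted_word q \<rho> (\<rho> t))(j := k)) = (twisted_word q \<rho> t)(i := k)"
      using hamming_map_fun_upd[OF swap_coord_bij _ twisted_word_vert[OF \<rho>_closed[OF t]], of "\<lambda>_. id" i k]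
        swap_twisted_word[OF \<rho>_closed[OF t]] \<rho>_invol[OF t] False i'(1) k
      by (simp add: swap_def j_def)
    moreover have "base_neighbour \<in> ?V"
      using base_neighbour_mem by (simp add: code_neighbours_def)
    ultimately have "(swap \<otimes>\<^bsub>BijGroup ?V\<^esub> g) base_neighbour = v"
      using g swap_code_aut v_eq
      by (simp add: BijGroup_def code_auts_def graph_auts_def compose_eq)
    then show ?thesis
      using subgroup.m_closed[OF subgroup_code_auts[OF code_verts] swap_code_aut g(1)] by blast
  qed
qed

theorem neighbour_transitive_code: "neighbour_transitive (2 * q) q code"
proof (rule neighbour_transitiveI)
  show "twisted_word q \<rho> id \<in> code"
    using T_id by blast
  fix x assume "x \<in> code"
  then obtain t where t: "t \<in> T" "x = twisted_word q \<rho> t"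
    by blast
  \<comment> \<open>Left multiplication alone is transitive on the code.\<close>
  then have "mult_map id t (twisted_word q \<rho> id) = x"
    using mult_map_twisted_word T_id by simp
  then show "\<exists>g\<in>code_auts (2 * q) q code. g (twisted_word q \<rho> id) = x"
    using mult_map_code_aut[OF T_id t(1)] by blast
qed (rule code_verts, rule base_neighbour_mem, rule code_neighbours_transitive)

end

section \<open>Reduction of the theorem to an involutory twist\<close>

theorem theorem4p2:
  fixes q :: nat
    and T :: "(nat \<Rightarrow> nat) set"
    and \<rho>\<^sub>1 \<rho>\<^sub>2 :: "(nat \<Rightarrow> nat) \<Rightarrow> nat \<Rightarrow> nat"
  assumes "subgroup T (sym_group q)"
    and "two_transitive {1..q} T"
    and "sporadic_case q T \<or>
         (\<exists>\<phi> :: nat \<Rightarrow> (('f::{field,finite}) ^ 'n) set. projective_case \<phi> q T)"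
    and "\<forall>t\<in>T. \<rho>\<^sub>1 t = t"
    and "\<rho>\<^sub>2 \<in> iso (perm_group q T) (perm_group q T)"
    and "\<not> induced_by_conjugation (sym_group q) T T \<rho>\<^sub>2"
    and "\<not> induced_by_conjugation (sym_group q) (normalizer (sym_group q) T) T \<rho>\<^sub>2"
    and "\<forall>t\<in>T. \<rho>\<^sub>2 (\<rho>\<^sub>2 t) = \<rho>\<^sub>1 t"
  shows "neighbour_transitive (2 * q) q (perm_code q T (\<rho>\<^sub>1, \<rho>\<^sub>2))"
proof -
  interpret S: group "sym_group q"
    by (rule sym_group_is_group)
  interpret T: subgroup T "sym_group q"
    by fact
  have perm: "t permutes {1..q}" if "t \<in> T" for t
    using T.subset that by (auto simp: sym_group_def)
  have id: "id \<in> T"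
    using T.one_closed by (simp add: sym_group_def)
  have closed: "\<rho>\<^sub>2 t \<in> T" if "t \<in> T" for t
    using assms(5) that by (auto simp: iso_def hom_def)
  \<comment> \<open>The base neighbour needs the letters 1 and 2. For smaller \<open>q\<close> the
    group is trivial, so \<open>\<rho>\<^sub>2\<close> would be conjugation by the identity and not
    outer.\<close>
  have "q \<ge> 2"
  proof (rule ccontr)
    assume "\<not> q \<ge> 2"
    then have "q = 0 \<or> q = 1"
      by auto
    then have trivial: "t = id" if "t \<in> T" for t
      using perm[OF that] by auto
    have "\<rho>\<^sub>2 t = t" if "t \<in> T" for t
      using trivial[OF that] trivial[OF closed[OF that]] by simp
    then have "\<rho>\<^sub>2 t = inv\<^bsub>sym_group q\<^esub> \<one>\<^bsub>sym_group q\<^esub> \<otimes>\<^bsub>sym_group q\<^esub> t \<otimes>\<^bsub>sym_group q\<^esub> \<one>\<^bsub>sym_group q\<^esub>"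
      if "t \<in> T" for t
      using that T.mem_carrier by simp
    then show False
      using assms(6) T.one_closed unfolding induced_by_conjugation_def by blast
  qed
  interpret involutory_twist q T \<rho>\<^sub>2
  proof
    fix t assume t: "t \<in> T"
    then show "inv' t \<in> T"
      using T.m_inv_closed[OF t] T.mem_carrier[OF t] by (simp add: sym_group_inv_equality)
  next
    fix s t assume st: "s \<in> T" "t \<in> T"
    then show "s \<circ> t \<in> T"
      using T.m_closed by (simp add: sym_group_def)
    show "\<rho>\<^sub>2 (s \<circ> t) = \<rho>\<^sub>2 s \<circ> \<rho>\<^sub>2 t"
      using assms(5) st by (auto simp: iso_def hom_def sym_group_def)
    show "\<rho>\<^sub>2 (\<rho>\<^sub>2 t) = t"
      using assms(4,8) st(2) by simp
  qed (rule \<open>q \<ge> 2\<close> | erule perm | rule id | rule assms(2) | erule closed)+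
  \<comment> \<open>Since \<open>\<rho>\<^sub>1\<close> fixes every \<open>t\<close> in
    \<open>T\<close>, the first half is \<open>t\<close> itself.\<close>
  have "join_words q (perm_word q t \<rho>\<^sub>1) (perm_word q t \<rho>\<^sub>2) = twisted_word q \<rho>\<^sub>2 t" if "t \<in> T" for t
    using assms(4) that by (auto simp: join_words_def perm_word_def twisted_word_def fun_eq_iff)
  then have "perm_code q T (\<rho>\<^sub>1, \<rho>\<^sub>2) = code"
    unfolding perm_code_def by force
  then show ?thesis
    using neighbour_transitive_code by simp
qed

end
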